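(* Let $m\in\mathbb{N}$, let $\alpha_j,\beta_j,\gamma,b,c\in\mathbb{C}$ $(j=1,\dots,m)$ and let $\kappa>0$ be real, with $\sum_{j=1}^m\Re(\alpha_j)>\max\{0,\kappa-1\}$, $\Re(\beta_j)>0$ for all $j$, and $\Re(\gamma)>0$. Let $\xi,\sigma\in\mathbb{C}$ with $\Re(\xi+\sigma)>0$ and $\Re(\xi)>0$, and let $y\in\mathbb{C}$. Then $$\int_0^1 x^{\xi+\sigma-1}(1-x)^{2\xi-1}\left(1-\frac{x}{3}\right)^{2(\xi+\sigma)-1}\left(1-\frac{x}{4}\right)^{\xi-1}\mathcal{J}_{(\beta_j)_m,\kappa,b}^{(\alpha_j)_m,\gamma,c}\left(y\left(1-\frac{x}{4}\right)(1-x)^2\right)dx$$ $$=\frac{\Gamma(\xi+\sigma)}{\Gamma(\gamma)}\left(\frac23\right)^{2(\xi+\sigma)}{}_2\Psi_{m+1}\left[\begin{array}{c}(\gamma,\kappa),(\xi,1)\\ \left(\beta_j+\frac{b+1}{2},\alpha_j\right)_{j=1}^m,(2\xi+\sigma,1)\end{array}\Big|\;cy\right].$$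
   Context: The generalized multiindex Bessel function is $$\mathcal{J}_{(\beta_j)_m,\kappa,b}^{(\alpha_j)_m,\gamma,c}[z]=\sum_{n=0}^\infty\frac{c^n(\gamma)_{\kappa n}}{\prod_{j=1}^m\Gamma\left(\alpha_jn+\beta_j+\frac{b+1}{2}\right)}\frac{z^n}{n!},\qquad (\gamma)_{\nu}=\frac{\Gamma(\gamma+\nu)}{\Gamma(\gamma)}.$$ The Fox–Wright function is given by the series $${}_p\Psi_q\left[\begin{array}{c}(a_1,A_1),\dots,(a_p,A_p)\\(b_1,B_1),\dots,(b_q,B_q)\end{array}\Big|\;z\right]=\sum_{n=0}^\infty\frac{\Gamma(a_1+A_1n)\cdots\Gamma(a_p+A_pn)}{\Gamma(b_1+B_1n)\cdots\Gamma(b_q+B_qn)}\frac{z^n}{n!},$$ where some of the $B_j$ may be complex (here $B_j=\alpha_j$). Throughout, $1/\Gamma$ is the entire reciprocal Gamma function, with value $0$ at the poles of $\Gamma$. The notation $\left(\beta_j+\frac{b+1}{2},\alpha_j\right)_{j=1}^m$ stands for the list of the $m$ pairs $\left(\beta_j+\frac{b+1}{2},\alpha_j\right)$. *)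

theory Defs
  imports "HOL-Analysis.Analysis"
begin

definition gen_pochhammer :: "complex \<Rightarrow> complex \<Rightarrow> complex" where
  "gen_pochhammer \<gamma> \<nu> = Gamma (\<gamma> + \<nu>) / Gamma \<gamma>"

(* rGamma is the entire reciprocal Gamma function, which vanishes at the poles of Gamma. *)

definition multiindex_bessel_term ::
  "nat \<Rightarrow> (nat \<Rightarrow> complex) \<Rightarrow> (nat \<Rightarrow> complex) \<Rightarrow> real \<Rightarrow> complex \<Rightarrow> complex \<Rightarrow> complex
    \<Rightarrow> complex \<Rightarrow> nat \<Rightarrow> complex" where
  "multiindex_bessel_term m \<alpha> \<beta> \<kappa> b \<gamma> c z n =
     c ^ n * gen_pochhammer \<gamma> (of_real \<kappa> * of_nat n)
       * (\<Prod>j=1..m. rGamma (\<alpha> j * of_nat n + \<beta> j + (b + 1) / 2))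
       * (z ^ n / fact n)"

definition multiindex_bessel ::
  "nat \<Rightarrow> (nat \<Rightarrow> complex) \<Rightarrow> (nat \<Rightarrow> complex) \<Rightarrow> real \<Rightarrow> complex \<Rightarrow> complex \<Rightarrow> complex
    \<Rightarrow> complex \<Rightarrow> complex" where
  "multiindex_bessel m \<alpha> \<beta> \<kappa> b \<gamma> c z = (\<Sum>n. multiindex_bessel_term m \<alpha> \<beta> \<kappa> b \<gamma> c z n)"

(* The two lists hold the upper pairs (a_i, A_i) and the lower pairs (b_j, B_j);
   p and q are their lengths. *)

definition fox_wright_term ::
  "(complex \<times> complex) list \<Rightarrow> (complex \<times> complex) list \<Rightarrow> complex \<Rightarrow> nat \<Rightarrow> complex" where
  "fox_wright_term as bs z n =
     (\<Prod>(a, A)\<leftarrow>as. Gamma (a + A * of_nat n)) * (\<Prod>(b, B)\<leftarrow>bs. rGamma (b + B * of_nat n))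
       * (z ^ n / fact n)"

definition fox_wright ::
  "(complex \<times> complex) list \<Rightarrow> (complex \<times> complex) list \<Rightarrow> complex \<Rightarrow> complex" where
  "fox_wright as bs z = (\<Sum>n. fox_wright_term as bs z n)"

end

theory Submission
  imports Defs "HOL-Real_Asymp.Real_Asymp"
begin

text \<open>
  Put g x = 9/4 * x * (1 - x/3)^2. Then 1 - g x = (1 - x)^2 * (1 - x/4) and
  g' x = 9/4 * (1 - x/3) * (1 - x), so the substitution t = g x turns Euler's Beta integral with
  parameters a = \<xi> + \<sigma> and \<xi> + n into the integral of the n-th term of the series on the left.
  The interchange of sum and integral is justified by dominated convergence, the series being
  absolutely convergent at y and the argument being at most y in modulus.

  Convergence only depends on the coefficient of n * ln n in the logarithm of the terms. Since
  the parameters \<alpha> j are complex, and may even have negative real part, the bound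
  for 1 / \<Gamma> (\<alpha> n + \<beta>) by exp (- Re \<alpha> * n * ln n + O(n)) cannot be reduced to the real line; the
  imaginary part costs a factor exp (O(n)), by comparison with the line Re z = 1/2 if
  Re \<alpha> \<ge> 0 and by the reflection formula if Re \<alpha> < 0.
\<close>

section \<open>Growth of the Gamma function along arithmetic progressions\<close>

lemma Gamma_complex_nonzero: "Gamma z \<noteq> 0" if "Re z > 0" for z :: complex
  using that nonpos_Ints_subset_nonpos_Reals[where 'a = complex]
  by (auto simp: Gamma_eq_zero_iff complex_nonpos_Reals_iff)

text \<open>In the Gauss product, the modulus of n^z depends only on Re z, and each factor satisfies
  |z + i| \<ge> Re z + i. The limit compares the reciprocals; inverting reverses the
  inequality.\<close>

lemma norm_Gamma_complex_le:
  fixes z :: complex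
  assumes "Re z > 0"
  shows "norm (Gamma z) \<le> Gamma (Re z)"
proof -
  have *: "norm (rGamma_series (complex_of_real (Re z)) n) \<le> norm (rGamma_series z n)" for n
  proof -
    have "norm (pochhammer (complex_of_real (Re z)) (n + 1)) \<le> norm (pochhammer z (n + 1))"
      unfolding pochhammer_prod prod_norm[symmetric]
    proof (intro prod_mono conjI norm_ge_zero)
      fix i
      have "norm (complex_of_real (Re z) + of_nat i) = Re z + i"
        using assms by (metis abs_of_nonneg add_nonneg_nonneg less_imp_le norm_of_real of_nat_0_le_iff of_real_add of_real_of_nat_eq)
      also have "\<dots> \<le> norm (z + of_nat i)"
        using complex_Re_le_cmod[of "z + of_nat i"] by simp
      finally show "norm (complex_of_real (Re z) + of_nat i) \<le> norm (z + of_nat i)" .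
    qed
    thus ?thesis
      by (simp add: rGamma_series_def norm_divide norm_mult divide_right_mono del: pochhammer_Suc)
  qed
  have "norm (rGamma (complex_of_real (Re z))) \<le> norm (rGamma z)"
    by (rule LIMSEQ_le[of "\<lambda>n. norm (rGamma_series (complex_of_real (Re z)) n)" _ "\<lambda>n. norm (rGamma_series z n)"])
       (use * in \<open>auto intro!: tendsto_intros\<close>)
  moreover have pos: "Gamma (Re z) > 0" using assms by simp
  ultimately have "inverse (Gamma (Re z)) \<le> inverse (norm (Gamma z))"
    unfolding rGamma_inverse_Gamma norm_inverse Gamma_complex_of_real norm_of_real by simp
  thus ?thesis
    using pos by (meson inverse_le_imp_le inverse_positive_iff_positive norm_ge_zero not_less order_le_less order_less_le_trans)
qed

lemma norm_sin_complex_le: "norm (sin z) \<le> exp \<bar>Im z\<bar>" for z :: complex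
proof -
  have "norm (sin z) = norm (exp (\<i> * z) - exp (- (\<i> * z))) / 2"
    by (simp add: sin_exp_eq norm_divide norm_mult)
  also have "\<dots> \<le> (norm (exp (\<i> * z)) + norm (exp (- (\<i> * z)))) / 2"
    by (intro divide_right_mono norm_triangle_ineq4) auto
  also have "\<dots> = (exp (- Im z) + exp (Im z)) / 2" by simp
  also have "\<dots> \<le> (exp \<bar>Im z\<bar> + exp \<bar>Im z\<bar>) / 2"
    by (intro divide_right_mono add_mono) auto
  finally show ?thesis by simp
qed

lemma norm_rGamma_half: "norm (rGamma (Complex (1/2) y)) \<le> rGamma (1/2) * exp (pi * \<bar>y\<bar> / 2)"
proof -
  let ?z = "Complex (1/2) y"
  have c: "1 - ?z = cnj ?z" by (simp add: complex_eq_iff)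
  have "norm (rGamma ?z) ^ 2 = norm (rGamma ?z * rGamma (1 - ?z))"
    unfolding c by (simp add: norm_mult power2_eq_square cnj_rGamma[symmetric])
  also have "\<dots> = norm (sin (of_real pi * ?z)) / pi"
    by (subst rGamma_reflection_complex) (simp add: norm_divide)
  also have "\<dots> \<le> exp (pi * \<bar>y\<bar>) / pi"
    using norm_sin_complex_le[of "of_real pi * ?z"] by (intro divide_right_mono) (auto simp: abs_mult)
  also have "\<dots> = (rGamma (1/2) * exp (pi * \<bar>y\<bar> / 2)) ^ 2"
    by (simp add: power_mult_distrib rGamma_inverse_Gamma Gamma_one_half_real power_inverse field_simps
          exp_double[symmetric] flip: exp_of_nat_mult)
  finally show ?thesis
    by (rule power2_le_imp_le) (auto simp: rGamma_inverse_Gamma)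
qed

text \<open>
  In the Gauss product, the quotients |x + k + i y| / (x + k) decrease in x, so the ratio of
  the two sides is largest at x = 1/2, where the reflection formula evaluates it.
\<close>
lemma norm_rGamma_le:
  assumes "x \<ge> 1/2"
  shows "norm (rGamma (Complex x y)) \<le> rGamma x * exp (pi * \<bar>y\<bar> / 2)"
proof -
  let ?r = "\<lambda>z. \<lambda>n. norm (rGamma_series z n)"
  have *: "?r (Complex x y) n * ?r (complex_of_real (1/2)) n \<le> ?r (complex_of_real x) n * ?r (Complex (1/2) y) n" for n
  proof -
    let ?p = "\<lambda>z. norm (pochhammer z (n + 1))"
    have "?p (Complex x y) * ?p (complex_of_real (1/2)) \<le> ?p (complex_of_real x) * ?p (Complex (1/2) y)"
      unfolding pochhammer_prod prod_norm[symmetric] prod.distrib[symmetric]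
    proof (intro prod_mono conjI mult_nonneg_nonneg norm_ge_zero)
      fix i :: nat
      have 1: "norm (complex_of_real u + of_nat i) = u + i" if "u > 0" for u
        using that by (metis abs_of_nonneg add_nonneg_nonneg less_imp_le norm_of_real of_nat_0_le_iff of_real_add of_real_of_nat_eq)
      have 2: "norm (Complex u y + of_nat i) = sqrt ((u + i)^2 + y^2)" for u
        by (simp add: cmod_def)
      have "sqrt ((x + i)^2 + y^2) * (1/2 + i) = sqrt (((x + i)^2 + y^2) * (1/2 + i)^2)"
        by (simp add: real_sqrt_mult)
      \<comment> \<open>Both radicands contain the product of the two squares, so only the terms
        with y^2 remain to be compared.\<close>
      also have "\<dots> \<le> sqrt (((1/2 + i)^2 + y^2) * (x + i)^2)"
      proof -
        have "(1/2 + real i)^2 \<le> (x + i)^2" using assms by (intro power_mono) auto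
        hence "y^2 * (1/2 + real i)^2 \<le> y^2 * (x + i)^2" by (rule mult_left_mono) auto
        thus ?thesis by (simp add: algebra_simps)
      qed
      also have "\<dots> = (x + i) * sqrt ((1/2 + i)^2 + y^2)"
        using assms by (simp add: real_sqrt_mult)
      finally show "norm (Complex x y + of_nat i) * norm (complex_of_real (1/2) + of_nat i)
          \<le> norm (complex_of_real x + of_nat i) * norm (Complex (1/2) y + of_nat i)"
        using assms by (subst (1 2) 1) (auto simp: 2)
    qed
    moreover have "norm (exp (Complex u y * of_real (ln (real n)))) = exp (u * ln (real n))"
      "norm (exp (complex_of_real u * of_real (ln (real n)))) = exp (u * ln (real n))" for u
      by simp_all
    \<comment> \<open>Since |n^z| depends only on Re z, both sides of the Gauss product inequality
      have the same denominator \<open>D\<close>.\<close>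
    ultimately have "?p (Complex x y) * ?p (complex_of_real (1/2)) / D \<le> ?p (complex_of_real x) * ?p (Complex (1/2) y) / D"
      and "?r (Complex x y) n * ?r (complex_of_real (1/2)) n = ?p (Complex x y) * ?p (complex_of_real (1/2)) / D"
      and "?r (complex_of_real x) n * ?r (Complex (1/2) y) n = ?p (complex_of_real x) * ?p (Complex (1/2) y) / D"
      if "D = fact n * exp (x * ln (real n)) * (fact n * exp (1/2 * ln (real n)))" for D
      unfolding rGamma_series_def norm_divide norm_mult times_divide_times_eq that norm_fact
      by (intro divide_right_mono, simp_all del: of_real_divide pochhammer_Suc)
    thus ?thesis by simp
  qed
  have "norm (rGamma (Complex x y)) * norm (rGamma (complex_of_real (1/2)))
      \<le> norm (rGamma (complex_of_real x)) * norm (rGamma (Complex (1/2) y))"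
    by (rule LIMSEQ_le[of "\<lambda>n. ?r (Complex x y) n * ?r (complex_of_real (1/2)) n" _
          "\<lambda>n. ?r (complex_of_real x) n * ?r (Complex (1/2) y) n"])
       (use * in \<open>auto intro!: tendsto_intros simp del: of_real_divide\<close>)
  also have "\<dots> \<le> norm (rGamma (complex_of_real x)) * (rGamma (1/2) * exp (pi * \<bar>y\<bar> / 2))"
    by (intro mult_left_mono norm_rGamma_half) auto
  finally have "norm (rGamma (Complex x y)) * rGamma (1/2) \<le> (rGamma x * exp (pi * \<bar>y\<bar> / 2)) * rGamma (1/2)"
    using assms unfolding rGamma_complex_of_real norm_of_real
    by (simp add: rGamma_inverse_Gamma mult_ac)
  moreover have "rGamma (1/2 :: real) > 0" by (simp add: rGamma_inverse_Gamma)
  ultimately show ?thesis by (rule mult_right_le_imp_le)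
qed

section \<open>Crude Stirling bounds on the real line\<close>

text \<open>Rounding up to a factorial suffices, because errors of order O(x) in the exponent are
  harmless. From 2 on the Gamma function is increasing.\<close>

lemma Gamma_real_le:
  fixes x :: real
  assumes "x \<ge> 2"
  shows "Gamma x \<le> exp ((x + 1) * ln (x + 1))"
proof -
  define N where "N = nat \<lceil>x\<rceil>"
  have N: "real N \<ge> x" "real N \<le> x + 1" using assms unfolding N_def by linarith+
  have "Gamma x \<le> Gamma (1 + real N)"
    using Gamma_real_strict_mono[of x "1 + real N"] N assms by auto
  also have "\<dots> = fact N" by (rule Gamma_fact)
  also have "\<dots> \<le> real N ^ N" using fact_le_power[of N, where 'a = real] by simp
  also have "\<dots> \<le> (x + 1) ^ N" using N by (intro power_mono) auto
  also have "\<dots> = (x + 1) powr N" using assms by (subst powr_realpow) auto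
  also have "\<dots> \<le> (x + 1) powr (x + 1)" using N assms by (intro powr_mono) auto
  finally show ?thesis using assms by (simp add: powr_def)
qed

text \<open>A single term of the exponential series gives N^N / N! \<le> e^N. It is used with an
  integer N between x - 2 and x - 1, for which N! \<le> \<Gamma>(x).\<close>

lemma rGamma_real_le:
  fixes x :: real
  assumes "x \<ge> 3"
  shows "rGamma x \<le> exp (x - (x - 2) * ln (x - 2))"
proof -
  define N where "N = nat \<lfloor>x - 1\<rfloor>"
  have "\<lfloor>x - 1\<rfloor> \<ge> 2" using assms by (simp add: le_floor_iff)
  hence N: "real N + 1 \<le> x" "x - 2 \<le> real N" "real N \<ge> 2" unfolding N_def by linarith+
  have pw: "(x - 2) powr (x - 2) \<le> exp N * fact N"
  proof -
    have "(x - 2) powr (x - 2) \<le> (x - 2) powr N" using N assms by (intro powr_mono) auto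
    also have "\<dots> \<le> real N powr N" using N assms by (intro powr_mono2) auto
    also have "\<dots> = real N ^ N" using N by (subst powr_realpow) auto
    also have "real N ^ N / fact N \<le> exp N"
      using exp_ge_zero sum_le_suminf[OF summable_exp_generic[of "real N"], of "{N}"]
      by (simp add: exp_def divide_inverse mult_ac)
    hence "real N ^ N \<le> exp N * fact N" by (simp add: field_simps)
    finally show ?thesis .
  qed
  have "fact N = Gamma (1 + real N)" by (rule Gamma_fact[symmetric])
  also have "\<dots> \<le> Gamma x"
    using Gamma_real_strict_mono[of "1 + real N" x] N by (cases "1 + real N = x") auto
  finally have "exp N * fact N \<le> exp x * Gamma x" using N by (intro mult_mono) auto
  hence "(x - 2) powr (x - 2) \<le> exp x * Gamma x" using pw by linarith
  moreover have "Gamma x > 0" using assms by auto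
  ultimately show ?thesis
    using assms by (simp add: powr_def rGamma_inverse_Gamma exp_diff exp_add field_simps)
qed

section \<open>Calculus of growth exponents\<close>

text \<open>The bound is n^(s n) * e^(K n). The geometric factor is hidden in \<open>K\<close>, so
  that \<open>s\<close> alone decides convergence when it is nonzero, and finitely many exceptional
  indices, such as those at poles, are ignored.\<close>

definition growth :: "real \<Rightarrow> (nat \<Rightarrow> complex) \<Rightarrow> bool" where
  "growth s f \<longleftrightarrow> (\<exists>K. eventually (\<lambda>n. norm (f n) \<le> exp (s * (real n * ln (real n)) + K * real n)) sequentially)"

lemma growthI:
  assumes "eventually (\<lambda>n. norm (f n) \<le> exp (s * (real n * ln (real n)) + K * real n)) sequentially"
  shows "growth s f"
  using assms unfolding growth_def by blast

lemma growth_mult: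
  assumes "growth s f" "growth t g"
  shows "growth (s + t) (\<lambda>n. f n * g n)"
proof -
  from assms obtain K L where
    "eventually (\<lambda>n. norm (f n) \<le> exp (s * (real n * ln (real n)) + K * real n)) sequentially"
    "eventually (\<lambda>n. norm (g n) \<le> exp (t * (real n * ln (real n)) + L * real n)) sequentially"
    unfolding growth_def by blast
  hence "eventually (\<lambda>n. norm (f n * g n) \<le> exp ((s + t) * (real n * ln (real n)) + (K + L) * real n)) sequentially"
  proof eventually_elim
    case (elim n)
    hence "norm (f n * g n) \<le> exp (s * (real n * ln (real n)) + K * real n) * exp (t * (real n * ln (real n)) + L * real n)"
      unfolding norm_mult by (intro mult_mono) auto
    thus ?case by (simp add: exp_add[symmetric] algebra_simps)
  qed
  thus ?thesis by (rule growthI)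
qed

text \<open>This reduces a growth claim to an asymptotic expansion of the exponent, in a form that
  \<open>real_asymp\<close> decides.\<close>

lemma growth_bigo:
  assumes "(\<lambda>n. g n - s * (real n * ln (real n))) \<in> O(\<lambda>n. real n)"
    and "eventually (\<lambda>n. norm (f n) \<le> exp (g n)) sequentially"
  shows "growth s f"
proof -
  from assms(1) obtain K where "eventually (\<lambda>n. norm (g n - s * (real n * ln (real n))) \<le> K * norm (real n)) sequentially"
    by (elim landau_o.bigE)
  with assms(2) have "eventually (\<lambda>n. norm (f n) \<le> exp (s * (real n * ln (real n)) + K * real n)) sequentially"
  proof eventually_elim
    case (elim n)
    have "g n \<le> s * (real n * ln (real n)) + K * real n" using elim(2) by auto
    with elim(1) show ?case by (meson exp_le_cancel_iff order_trans)
  qed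
  thus ?thesis by (rule growthI)
qed

lemma growth_const: "growth 0 (\<lambda>n. c)"
proof (rule growth_bigo[of "\<lambda>n. norm c"])
  show "\<forall>\<^sub>F n in sequentially. norm c \<le> exp (norm c)"
    using exp_ge_add_one_self[of "norm c"] by (intro always_eventually allI) linarith
  show "(\<lambda>n. norm c - 0 * (real n * ln (real n))) \<in> O(\<lambda>n. real n)" by simp real_asymp
qed

lemma growth_power: "growth 0 (\<lambda>n. c ^ n)"
proof (rule growthI[where K = "norm c"], intro always_eventually allI)
  fix n
  have "norm c \<le> exp (norm c)" using exp_ge_add_one_self[of "norm c"] by linarith
  hence "norm c ^ n \<le> exp (norm c) ^ n" by (intro power_mono) auto
  thus "norm (c ^ n) \<le> exp (0 * (real n * ln (real n)) + norm c * real n)"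
    by (simp add: norm_power exp_of_nat_mult[symmetric] mult_ac)
qed

lemma growth_linear: "growth 0 (\<lambda>n. a * of_nat n + b)"
proof (rule growth_bigo[of "\<lambda>n. norm a * real n + norm b"])
  show "\<forall>\<^sub>F n in sequentially. norm (a * of_nat n + b) \<le> exp (norm a * real n + norm b)"
  proof (intro always_eventually allI)
    fix n :: nat
    have "norm (a * of_nat n + b) \<le> norm a * real n + norm b"
      by (metis norm_triangle_ineq norm_mult norm_of_nat)
    also have "\<dots> \<le> exp (norm a * real n + norm b)"
      using exp_ge_add_one_self[of "norm a * real n + norm b"] by linarith
    finally show "norm (a * of_nat n + b) \<le> exp (norm a * real n + norm b)" .
  qed
  show "(\<lambda>n. norm a * real n + norm b - 0 * (real n * ln (real n))) \<in> O(\<lambda>n. real n)" by simp real_asymp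
qed

lemma growth_prod:
  assumes "finite A" "\<And>j. j \<in> A \<Longrightarrow> growth (s j) (f j)"
  shows "growth (\<Sum>j\<in>A. s j) (\<lambda>n. \<Prod>j\<in>A. f j n)"
  using assms by (induction rule: finite_induct) (auto intro: growth_const growth_mult)

section \<open>Growth exponents of Gamma and its reciprocal along arithmetic progressions\<close>

lemma growth_Gamma_real:
  fixes a b :: real
  assumes "a \<ge> 0"
  shows "growth a (\<lambda>n. of_real (Gamma (a * n + b)))"
\<comment> \<open>For \<open>a = 0\<close> the sequence is constant; the Stirling bound applies only
  when the argument tends to infinity.\<close>
proof (cases "a = 0")
  case True
  thus ?thesis using growth_const by simp
next
  case False
  with assms have a: "a > 0" by simp
  show ?thesis
  proof (rule growth_bigo)
    have "eventually (\<lambda>n. a * real n + b \<ge> 2) sequentially" using a by real_asymp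
    thus "eventually (\<lambda>n. norm (complex_of_real (Gamma (a * n + b))) \<le> exp ((a * n + b + 1) * ln (a * n + b + 1))) sequentially"
    proof eventually_elim
      case (elim n)
      thus ?case using Gamma_real_le[of "a * n + b"] by (simp add: abs_of_nonneg Gamma_real_nonneg)
    qed
    show "(\<lambda>n. (a * real n + b + 1) * ln (a * real n + b + 1) - a * (real n * ln (real n))) \<in> O(\<lambda>n. real n)"
      using a by real_asymp
  qed
qed

lemma growth_rGamma_real:
  fixes a b :: real
  assumes "a \<ge> 0"
  shows "growth (- a) (\<lambda>n. of_real (rGamma (a * n + b)))"
proof (cases "a = 0")
  case True
  thus ?thesis using growth_const by simp
next
  case False
  with assms have a: "a > 0" by simp
  show ?thesis
  proof (rule growth_bigo)
    have "eventually (\<lambda>n. a * real n + b \<ge> 3) sequentially" using a by real_asymp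
    thus "eventually (\<lambda>n. norm (complex_of_real (rGamma (a * n + b)))
        \<le> exp ((a * n + b) - (a * n + b - 2) * ln (a * n + b - 2))) sequentially"
    proof eventually_elim
      case (elim n)
      thus ?case using rGamma_real_le[of "a * n + b"]
        by (simp add: abs_of_nonneg rGamma_inverse_Gamma del: of_real_inverse)
    qed
    show "(\<lambda>n. (a * real n + b) - (a * real n + b - 2) * ln (a * real n + b - 2) - (- a) * (real n * ln (real n))) \<in> O(\<lambda>n. real n)"
      using a by real_asymp
  qed
qed

lemma growth_mono:
  assumes "growth s g" "eventually (\<lambda>n. norm (f n) \<le> norm (g n)) sequentially"
  shows "growth s f"
proof -
  from assms(1) obtain K where "eventually (\<lambda>n. norm (g n) \<le> exp (s * (real n * ln (real n)) + K * real n)) sequentially"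
    unfolding growth_def by blast
  with assms(2) have "eventually (\<lambda>n. norm (f n) \<le> exp (s * (real n * ln (real n)) + K * real n)) sequentially"
    by eventually_elim linarith
  thus ?thesis by (rule growthI)
qed

lemma growth_Gamma:
  assumes "\<kappa> > 0"
  shows "growth \<kappa> (\<lambda>n. Gamma (of_real \<kappa> * of_nat n + b))"
proof (rule growth_mono[OF growth_Gamma_real])
  have "eventually (\<lambda>n. \<kappa> * real n + Re b > 0) sequentially" using assms by real_asymp
  thus "eventually (\<lambda>n. norm (Gamma (of_real \<kappa> * of_nat n + b)) \<le> norm (complex_of_real (Gamma (\<kappa> * n + Re b)))) sequentially"
  proof eventually_elim
    case (elim n)
    thus ?case using norm_Gamma_complex_le[of "of_real \<kappa> * of_nat n + b"] by simp
  qed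
qed (use assms in auto)

text \<open>Such factors measure the cost of the imaginary parts: the exponent is linear in n and
  does not affect the growth exponent.\<close>

lemma growth_exp_im: "growth 0 (\<lambda>n. of_real (exp (C * \<bar>p * real n + q\<bar>)))"
proof (rule growth_bigo[of "\<lambda>n. \<bar>C\<bar> * (\<bar>p\<bar> * real n + \<bar>q\<bar>)"])
  show "\<forall>\<^sub>F n in sequentially. norm (complex_of_real (exp (C * \<bar>p * real n + q\<bar>))) \<le> exp (\<bar>C\<bar> * (\<bar>p\<bar> * real n + \<bar>q\<bar>))"
  proof (intro always_eventually allI)
    fix n :: nat
    have "\<bar>p * real n + q\<bar> \<le> \<bar>p\<bar> * real n + \<bar>q\<bar>"
      by (metis abs_mult abs_of_nat abs_triangle_ineq)
    hence "C * \<bar>p * real n + q\<bar> \<le> \<bar>C\<bar> * (\<bar>p\<bar> * real n + \<bar>q\<bar>)"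
      by (intro mult_mono) auto
    thus "norm (complex_of_real (exp (C * \<bar>p * real n + q\<bar>))) \<le> exp (\<bar>C\<bar> * (\<bar>p\<bar> * real n + \<bar>q\<bar>))" by simp
  qed
  show "(\<lambda>n. \<bar>C\<bar> * (\<bar>p\<bar> * real n + \<bar>q\<bar>) - 0 * (real n * ln (real n))) \<in> O(\<lambda>n. real n)"
    by real_asymp
qed

lemma growth_rGamma: "growth (- Re \<alpha>) (\<lambda>n. rGamma (\<alpha> * of_nat n + \<beta>))"
proof (cases "Re \<alpha> < 0")
  case True
  have "growth (- Re \<alpha> + 0) (\<lambda>n. of_real (Gamma ((- Re \<alpha>) * n + (1 - Re \<beta>))) *
      of_real (exp (pi * \<bar>Im \<alpha> * real n + Im \<beta>\<bar>)))"
    using True by (intro growth_mult growth_Gamma_real growth_exp_im) auto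
  moreover have "eventually (\<lambda>n. - Re \<alpha> * real n + (1 - Re \<beta>) > 0) sequentially" using True by real_asymp
  hence "eventually (\<lambda>n. norm (rGamma (\<alpha> * of_nat n + \<beta>)) \<le> norm (of_real (Gamma ((- Re \<alpha>) * n + (1 - Re \<beta>))) *
      complex_of_real (exp (pi * \<bar>Im \<alpha> * real n + Im \<beta>\<bar>)))) sequentially"
  proof eventually_elim
    case (elim n)
    let ?z = "\<alpha> * of_nat n + \<beta>"
    \<comment> \<open>The reflected argument lies in the right half-plane, where \<Gamma> is bounded
      by its value at the real part; the sine costs only e^(O(n)).\<close>
    have re: "Re (1 - ?z) > 0" using elim by simp
    have "rGamma (1 - ?z) \<noteq> 0"
      using Gamma_complex_nonzero[OF re] by (simp add: rGamma_inverse_Gamma)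
    hence "rGamma ?z = sin (of_real pi * ?z) / of_real pi * Gamma (1 - ?z)"
      using rGamma_reflection_complex[of ?z] by (simp add: Gamma_def field_simps)
    hence "norm (rGamma ?z) = norm (sin (of_real pi * ?z)) / pi * norm (Gamma (1 - ?z))"
      by (simp add: norm_mult norm_divide)
    also have "\<dots> \<le> exp \<bar>Im (of_real pi * ?z)\<bar> / 1 * Gamma (Re (1 - ?z))"
      using pi_gt3 by (intro mult_mono frac_le norm_sin_complex_le norm_Gamma_complex_le re) auto
    also have "\<bar>Im (of_real pi * ?z)\<bar> = pi * \<bar>Im \<alpha> * real n + Im \<beta>\<bar>" by (simp add: abs_mult)
    also have "Re (1 - ?z) = - Re \<alpha> * real n + (1 - Re \<beta>)" by simp
    finally show ?case using Gamma_real_pos[OF elim] by (simp add: norm_mult mult_ac)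
  qed
  ultimately show ?thesis using growth_mono by simp
next
  case False
  \<comment> \<open>The shift by \<open>k\<close> moves every argument to real part at least 1, as
    Re \<alpha> \<ge> 0. This also covers Re \<alpha> = 0, where the real part does not grow with
    n.\<close>
  define k where "k = nat \<lceil>1 - Re \<beta>\<rceil>"
  have k: "Re \<beta> + real k \<ge> 1" unfolding k_def by linarith
  \<comment> \<open>The price of the shift is a product of \<open>k\<close> factors linear in n,
    hence of exponent 0.\<close>
  have "growth (\<Sum>i\<in>{0..<k}. 0) (\<lambda>n. \<Prod>i\<in>{0..<k}. \<alpha> * of_nat n + (\<beta> + of_nat i))"
    by (intro growth_prod growth_linear) auto
  hence p: "growth 0 (\<lambda>n. pochhammer (\<alpha> * of_nat n + \<beta>) k)"
    by (simp add: pochhammer_prod add_ac)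
  have "growth (0 + (- Re \<alpha> + 0)) (\<lambda>n. pochhammer (\<alpha> * of_nat n + \<beta>) k *
     (of_real (rGamma (Re \<alpha> * n + (Re \<beta> + k))) * of_real (exp (pi / 2 * \<bar>Im \<alpha> * real n + Im \<beta>\<bar>))))"
    using False by (intro growth_mult growth_rGamma_real growth_exp_im p) auto
  moreover have "norm (rGamma (\<alpha> * of_nat n + \<beta>)) \<le> norm (pochhammer (\<alpha> * of_nat n + \<beta>) k *
     (of_real (rGamma (Re \<alpha> * n + (Re \<beta> + k))) * of_real (exp (pi / 2 * \<bar>Im \<alpha> * real n + Im \<beta>\<bar>))))" for n
  proof -
    let ?z = "\<alpha> * of_nat n + \<beta>" and ?x = "Re \<alpha> * n + (Re \<beta> + k)"
    have x: "?x \<ge> 1" using False k add_increasing[of "Re \<alpha> * n" 1 "Re \<beta> + k"] by auto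
    have "rGamma ?z = pochhammer ?z k * rGamma (?z + of_nat k)" by (rule pochhammer_rGamma)
    also have "?z + of_nat k = Complex ?x (Im \<alpha> * n + Im \<beta>)" by (simp add: complex_eq_iff)
    finally show ?thesis
      using norm_rGamma_le[of ?x "Im \<alpha> * n + Im \<beta>"] x Gamma_real_pos[of ?x]
      by (auto simp: norm_mult rGamma_inverse_Gamma abs_of_nonneg simp del: of_real_inverse Gamma_real_pos
          intro!: mult_left_mono)
  qed
  ultimately show ?thesis using growth_mono by simp
qed

text \<open>A negative multiple of n ln n outweighs any K n, so the terms eventually lie below a
  geometric sequence.\<close>

lemma growth_summable:
  assumes "growth s f" "s < 0"
  shows "summable (\<lambda>n. norm (f n))"
proof -
  from assms(1) obtain K where K: "eventually (\<lambda>n. norm (f n) \<le> exp (s * (real n * ln (real n)) + K * real n)) sequentially"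
    unfolding growth_def by blast
  have "eventually (\<lambda>n. exp (s * (real n * ln (real n)) + K * real n) \<le> (1/2) ^ n) sequentially"
    using assms(2) by real_asymp
  with K have "eventually (\<lambda>n. norm (norm (f n)) \<le> (1/2) ^ n) sequentially"
    by eventually_elim auto
  thus ?thesis by (rule summable_comparison_test_ev) (auto intro: summable_geometric)
qed

section \<open>The complex Beta integral and the Lavoie-Trottier integral\<close>

lemma norm_complex_of_real_powr:
  assumes "x \<ge> 0"
  shows "norm (complex_of_real x powr z) = x powr Re z"
  using assms by (simp add: norm_powr_real_powr)

lemma set_integrable_Beta_complex:
  fixes a b :: complex
  assumes "Re a > 0" "Re b > 0"
  shows "set_integrable lborel {0<..<1} (\<lambda>t. of_real t powr (a - 1) * of_real (1 - t) powr (b - 1))"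
proof -
  have "set_integrable lborel {0..1} (\<lambda>t. t powr (Re a - 1) * (1 - t) powr (Re b - 1))"
    using integrable_Beta[of "Re a" "Re b"] assms by simp
  hence "set_integrable lborel {0<..<1} (\<lambda>t. t powr (Re a - 1) * (1 - t) powr (Re b - 1))"
    by (rule set_integrable_subset) auto
  thus ?thesis unfolding set_integrable_def
  proof (rule Bochner_Integration.integrable_bound)
    have "(\<lambda>t. indicat_real {0<..<1} t *\<^sub>R (complex_of_real t powr (a - 1) * complex_of_real (1 - t) powr (b - 1))) \<in> borel_measurable borel"
      by (intro borel_measurable_continuous_on_indicator continuous_intros) (auto simp: complex_nonpos_Reals_iff)
    thus "(\<lambda>t. indicat_real {0<..<1} t *\<^sub>R (complex_of_real t powr (a - 1) * complex_of_real (1 - t) powr (b - 1))) \<in> borel_measurable lborel"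
      by simp
    show "AE t in lborel. norm (indicat_real {0<..<1} t *\<^sub>R (complex_of_real t powr (a - 1) * complex_of_real (1 - t) powr (b - 1)))
        \<le> norm (indicat_real {0<..<1} t *\<^sub>R (t powr (Re a - 1) * (1 - t) powr (Re b - 1)))"
      by (intro AE_I2) (auto simp: indicator_def norm_mult norm_complex_of_real_powr simp del: of_real_diff)
  qed
qed

text \<open>Euler's integrand for \<Gamma>(z), unnormalised and extended by zero to the whole line,
  so that the Beta integral arises from a convolution over the line.\<close>

definition gamma_density :: "complex \<Rightarrow> real \<Rightarrow> complex" where
  "gamma_density z t = indicat_real {0<..} t *\<^sub>R (of_real t powr (z - 1) / of_real (exp t))"

lemma gamma_density_measurable [measurable]: "gamma_density z \<in> borel_measurable borel"
  unfolding gamma_density_def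
  by (intro borel_measurable_continuous_on_indicator continuous_intros) (auto simp: complex_nonpos_Reals_iff)

lemma gamma_density_integral:
  assumes "Re z > 0"
  shows "integrable lborel (gamma_density z)" "integral\<^sup>L lborel (gamma_density z) = Gamma z"
proof -
  have "(\<lambda>t. complex_of_real t powr (z - 1) / of_real (exp (1 * t))) absolutely_integrable_on {0<..}"
    using assms by (intro absolutely_integrable_Gamma_integral) auto
  hence *: "integrable lebesgue (gamma_density z)"
    unfolding gamma_density_def set_integrable_def by simp
  thus int: "integrable lborel (gamma_density z)"
    by (subst (asm) integrable_completion) auto
  have "((\<lambda>t. complex_of_real t powr (z - 1) / of_real (exp t)) has_integral Gamma z) {0..}"
    by (rule Gamma_integral_complex[OF assms])
  hence "((\<lambda>t. complex_of_real t powr (z - 1) / of_real (exp t)) has_integral Gamma z) {0<..}"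
    by (subst (asm) has_integral_spike_set_eq[of _ "{0<..}"]) (auto intro: negligible_subset[of "{0}"])
  hence "(gamma_density z has_integral Gamma z) UNIV"
    unfolding gamma_density_def
    by (subst (asm) has_integral_restrict_UNIV[symmetric])
       (erule has_integral_eq_rhs[OF has_integral_eq, rotated], auto simp: indicator_def)
  moreover have "(gamma_density z has_integral integral\<^sup>L lborel (gamma_density z)) UNIV"
    by (rule has_integral_integral_lborel[OF int])
  ultimately show "integral\<^sup>L lborel (gamma_density z) = Gamma z"
    using has_integral_unique by blast
qed

text \<open>Scaling the integration variable by \<open>u\<close> separates the powers of
  \<open>u\<close> from a Beta integrand, while the two exponentials combine to exp(-u).\<close>

lemma gamma_density_convolution:
  assumes u: "u > 0"
  shows "(LINT t|lborel. gamma_density a t * gamma_density b (u - t))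
     = gamma_density (a + b) u * (LINT t:{0<..<1}|lborel. of_real t powr (a - 1) * of_real (1 - t) powr (b - 1))"
proof -
  have "(LINT t|lborel. gamma_density a t * gamma_density b (u - t)) =
    \<bar>u\<bar> *\<^sub>R (LINT t|lborel. gamma_density a (0 + u * t) * gamma_density b (u - (0 + u * t)))"
    using u by (intro lborel_integral_real_affine) auto
  \<comment> \<open>The powers of \<open>u\<close> have total exponent a + b - 2, one short of that
    in \<open>gamma_density (a + b) u\<close>; the Jacobian supplies the missing factor
    \<open>u\<close>.\<close>
  also have "(\<lambda>t. gamma_density a (0 + u * t) * gamma_density b (u - (0 + u * t))) =
     (\<lambda>t. gamma_density (a + b) u / of_real u * (indicat_real {0<..<1} t *\<^sub>R (of_real t powr (a - 1) * of_real (1 - t) powr (b - 1))))"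
  proof
    fix t
    show "gamma_density a (0 + u * t) * gamma_density b (u - (0 + u * t)) =
      gamma_density (a + b) u / of_real u * (indicat_real {0<..<1} t *\<^sub>R (of_real t powr (a - 1) * of_real (1 - t) powr (b - 1)))"
    proof (cases "t \<in> {0<..<1}")
      case True
      have e: "u - u * t = u * (1 - t)" by (simp add: algebra_simps)
      have p: "complex_of_real (u * s) powr w = of_real u powr w * of_real s powr w" if "s > 0" for s w
        using u that by (simp add: powr_times_real)
      have "complex_of_real u powr (a - 1) * of_real u powr (b - 1) = of_real u powr (a + b - 1) / of_real u"
        using u by (simp add: powr_diff powr_add)
      moreover have "exp (u * t) * exp (u * (1 - t)) = exp u"
        by (simp add: exp_add[symmetric] algebra_simps)
      hence "complex_of_real (exp (u * t)) * complex_of_real (exp (u * (1 - t))) = complex_of_real (exp u)"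
        by (metis of_real_mult)
      ultimately show ?thesis using True u
        unfolding gamma_density_def add_0 e
        by (simp add: indicator_def p del: of_real_mult of_real_diff) (simp add: field_simps)
    next
      case False
      \<comment> \<open>In the first case the density of \<open>a\<close> vanishes, in the second
        that of \<open>b\<close>.\<close>
      hence "u * t \<le> 0 \<or> u * t \<ge> u" using u by (auto simp: mult_le_0_iff)
      thus ?thesis using False unfolding gamma_density_def by (auto simp: indicator_def)
    qed
  qed
  also have "\<bar>u\<bar> *\<^sub>R (LINT t|lborel. gamma_density (a + b) u / of_real u * (indicat_real {0<..<1} t *\<^sub>R (of_real t powr (a - 1) * of_real (1 - t) powr (b - 1))))
    = gamma_density (a + b) u * (LINT t:{0<..<1}|lborel. of_real t powr (a - 1) * of_real (1 - t) powr (b - 1))"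
    using u by (simp add: set_lebesgue_integral_def scaleR_conv_of_real)
  finally show ?thesis .
qed

text \<open>The double integral of the product of two densities is computed in both orders.
  Integrating first in \<open>u\<close> gives \<Gamma>(a) \<Gamma>(b) by translation invariance;
  integrating first in \<open>t\<close> gives \<Gamma>(a + b) times the Beta integral.\<close>

lemma set_lebesgue_integral_Beta_complex:
  fixes a b :: complex
  assumes a: "Re a > 0" and b: "Re b > 0"
  shows "(LINT t:{0<..<1}|lborel. of_real t powr (a - 1) * of_real (1 - t) powr (b - 1)) = Beta a b"
proof -
  define I where "I = (LINT t:{0<..<1}|lborel. complex_of_real t powr (a - 1) * of_real (1 - t) powr (b - 1))"
  let ?h = "\<lambda>(t, u). gamma_density a t * gamma_density b (u - t)"
  have shift: "integrable lborel (\<lambda>u. f (u - t))" "(LINT u|lborel. f (u - t)) = integral\<^sup>L lborel f"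
    if "integrable lborel f" for f :: "real \<Rightarrow> 'b::{banach, second_countable_topology}" and t
    using lborel_integrable_real_affine[OF that, of 1 "- t"] lborel_integral_real_affine[of 1 f "- t"]
    by (simp_all)
  have h: "integrable (lborel \<Otimes>\<^sub>M lborel) ?h"
  proof (rule lborel_pair.Fubini_integrable)
    show "?h \<in> borel_measurable (lborel \<Otimes>\<^sub>M lborel)" by measurable
    \<comment> \<open>Translation invariance makes the inner integral of the modulus a constant
      multiple of \<open>norm (gamma_density a t)\<close>.\<close>
    have "(\<lambda>t. LINT u|lborel. norm (?h (t, u))) = (\<lambda>t. norm (gamma_density a t) * (LINT u|lborel. norm (gamma_density b u)))"
      using shift(2)[OF integrable_norm[OF gamma_density_integral(1)[OF b]]] by (simp add: norm_mult)
    thus "integrable lborel (\<lambda>t. LINT u|lborel. norm (?h (t, u)))"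
      using gamma_density_integral(1)[OF a] by simp
    show "AE t in lborel. integrable lborel (\<lambda>u. ?h (t, u))"
      using shift(1)[OF gamma_density_integral(1)[OF b]] by simp
  qed
  have "(LINT u|lborel. LINT t|lborel. ?h (t, u)) = (LINT t|lborel. LINT u|lborel. ?h (t, u))"
    using lborel_pair.Fubini_integral[OF h] by simp
  also have "\<dots> = Gamma a * Gamma b"
    using shift(2)[OF gamma_density_integral(1)[OF b]] gamma_density_integral[OF b] gamma_density_integral[OF a] by simp
  also have "(\<lambda>u. LINT t|lborel. ?h (t, u)) = (\<lambda>u. gamma_density (a + b) u * I)"
  proof
    fix u
    show "(LINT t|lborel. ?h (t, u)) = gamma_density (a + b) u * I"
    proof (cases "u > 0")
      case True
      thus ?thesis using gamma_density_convolution[of u a b] by (simp add: I_def)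
    next
      case False
      hence "(\<lambda>t. gamma_density a t * gamma_density b (u - t)) = (\<lambda>t. 0)"
        by (auto simp: gamma_density_def indicator_def)
      moreover have "gamma_density (a + b) u = 0" using False by (simp add: gamma_density_def)
      ultimately show ?thesis by simp
    qed
  qed
  also have "(LINT u|lborel. gamma_density (a + b) u * I) = Gamma (a + b) * I"
    using gamma_density_integral[of "a + b"] a b by simp
  finally have "Gamma (a + b) * I = Gamma a * Gamma b" .
  moreover have "Gamma (a + b) \<noteq> 0"
    using a b by (intro Gamma_complex_nonzero) simp
  ultimately show ?thesis unfolding I_def[symmetric] Beta_def by (simp add: field_simps)
qed

section \<open>The Lavoie-Trottier integral by substitution\<close>

lemma integral_Lavoie_Trottier:
  fixes a b :: complex
  assumes "Re a > 0" "Re b > 0"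
  defines "f \<equiv> \<lambda>x::real. of_real x powr (a - 1) * of_real (1 - x) powr (2 * b - 1)
      * of_real (1 - x / 3) powr (2 * a - 1) * of_real (1 - x / 4) powr (b - 1)"
  shows "f absolutely_integrable_on {0<..<1}"
    and "integral {0<..<1} f = (2 / 3) powr (2 * a) * Beta a b"
proof -
  \<comment> \<open>The factor 9/4 normalises \<open>g 1 = 1\<close>, so that \<open>g\<close> maps
    the unit interval onto itself.\<close>
  define g where "g = (\<lambda>x::real. 9 / 4 * x * (1 - x / 3)^2)"
  define g' where "g' = (\<lambda>x::real. 9 / 4 * (1 - x / 3) * (1 - x))"
  let ?B = "\<lambda>t::real. complex_of_real t powr (a - 1) * complex_of_real (1 - t) powr (b - 1)"
  have g1: "1 - g x = (1 - x)^2 * (1 - x / 4)" for x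
    unfolding g_def by (simp add: field_simps power2_eq_square)
  have deriv: "(g has_field_derivative g' x) (at x within S)" for x S
    unfolding g_def g'_def by (auto intro!: derivative_eq_intros simp: field_simps power2_eq_square)
  have g'pos: "g' x > 0" if "x \<in> {0<..<1}" for x using that by (simp add: g'_def)
  have strict: "g x < g y" if "0 < x" "x < y" "y < 1" for x y
    by (rule DERIV_pos_imp_increasing[OF that(2)]) (use that deriv g'pos in force)
  have inj: "inj_on g {0<..<1}"
    using strict by (intro linorder_inj_onI) fastforce+
  have cont: "continuous_on {0..1} g" unfolding g_def by (intro continuous_intros) auto
  have img: "g ` {0<..<1} = {0<..<1}"
  proof (intro equalityI subsetI)
    fix t assume "t \<in> g ` {0<..<1}"
    then obtain x where x: "0 < x" "x < 1" "t = g x" by auto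
    have "g x > 0" using x by (simp add: g_def)
    moreover have "1 - g x > 0" unfolding g1 using x by simp
    ultimately show "t \<in> {0<..<1}" using x by simp
  next
    fix t :: real assume t: "t \<in> {0<..<1}"
    have "\<exists>x\<ge>0. x \<le> 1 \<and> g x = t"
      using t cont by (intro IVT') (auto simp: g_def power2_eq_square)
    then obtain x where x: "0 \<le> x" "x \<le> 1" "g x = t" by auto
    moreover have "x \<noteq> 0" "x \<noteq> 1" using x t by (auto simp: g_def power2_eq_square)
    ultimately show "t \<in> g ` {0<..<1}" by (intro image_eqI[of _ _ x]) auto
  qed
  have Bint: "set_integrable lborel {0<..<1} ?B" by (rule set_integrable_Beta_complex) fact+
  have "?B absolutely_integrable_on {0<..<1} \<and> integral {0<..<1} ?B = Beta a b"
    using set_borel_integral_eq_integral[OF Bint] set_lebesgue_integral_Beta_complex[OF assms(1,2)] Bint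
      integrable_completion[of "\<lambda>t. indicat_real {0<..<1} t *\<^sub>R ?B t" lborel]
    by (simp add: set_integrable_def borel_measurable_integrable)
  hence "?B absolutely_integrable_on g ` {0<..<1} \<and> integral (g ` {0<..<1}) ?B = Beta a b"
    unfolding img .
  hence *: "(\<lambda>x. \<bar>g' x\<bar> *\<^sub>R ?B (g x)) absolutely_integrable_on {0<..<1}"
    "integral {0<..<1} (\<lambda>x. \<bar>g' x\<bar> *\<^sub>R ?B (g x)) = Beta a b"
    using has_absolute_integral_change_of_variables_real[of "{0<..<1}" g g' ?B "Beta a b"] deriv inj by auto
  \<comment> \<open>This is (9/4)^(-a), which cancels the constant (9/4)^a produced by
    \<open>g\<close> and its derivative.\<close>
  define C where "C = complex_of_real (2 / 3) powr (2 * a)"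
  have eq: "f x = C * (\<bar>g' x\<bar> *\<^sub>R ?B (g x))" if x: "x \<in> {0<..<1}" for x
  proof -
    \<comment> \<open>All bases are positive reals, so each complex power is an exponential of a
      real logarithm. The identity becomes linear in these five logarithms and no branch of the
      logarithm intervenes.\<close>
    define X Y P Q K where "X = complex_of_real (ln x)" "Y = complex_of_real (ln (1 - x))"
      "P = complex_of_real (ln (1 - x / 3))" "Q = complex_of_real (ln (1 - x / 4))" "K = complex_of_real (ln (2 / 3))"
    have pw: "complex_of_real s powr w = exp (w * of_real (ln s))" if "s > 0" for s w
      using that by (simp add: powr_def Ln_of_real)
    have ex: "complex_of_real s = exp (of_real (ln s))" if "s > 0" for s
      using that by (simp add: exp_of_real)
    have q: "ln (9 / 4 :: real) = - 2 * ln (2 / 3)"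
      using ln_realpow[of "2/3 :: real" 2] by (simp add: ln_div power2_eq_square)
    have "g x > 0" "1 - g x > 0" using x img by auto
    have "ln (g x) = ln (9 / 4) + ln x + 2 * ln (1 - x / 3)"
      unfolding g_def using ln_mult[of "9 / 4 * x" "(1 - x / 3)^2"] ln_mult[of "9 / 4" x] x
      by (simp add: ln_realpow)
    hence lg: "complex_of_real (ln (g x)) = - 2 * K + X + 2 * P"
      unfolding q X_Y_P_Q_K_def by simp
    have "ln (1 - g x) = 2 * ln (1 - x) + ln (1 - x / 4)"
      unfolding g1 using x by (simp add: ln_mult ln_realpow)
    hence l1: "complex_of_real (ln (1 - g x)) = 2 * Y + Q" unfolding X_Y_P_Q_K_def by simp
    have "ln (g' x) = ln (9 / 4) + ln (1 - x / 3) + ln (1 - x)"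
      unfolding g'_def using ln_mult[of "9 / 4 * (1 - x / 3)" "1 - x"] ln_mult[of "9 / 4" "1 - x / 3"] x
      by simp
    hence lg': "complex_of_real (ln (g' x)) = - 2 * K + P + Y"
      unfolding q X_Y_P_Q_K_def by simp
    have "C * (\<bar>g' x\<bar> *\<^sub>R ?B (g x)) = exp (2 * a * K) * (exp (- 2 * K + P + Y) *
       (exp ((a - 1) * (- 2 * K + X + 2 * P)) * exp ((b - 1) * (2 * Y + Q))))"
      using g'pos[OF x] \<open>g x > 0\<close> \<open>1 - g x > 0\<close>
      unfolding C_def scaleR_conv_of_real
      by (simp add: pw ex[of "g' x"] lg l1 lg' X_Y_P_Q_K_def(5) del: of_real_divide of_real_diff)
    \<comment> \<open>Collecting coefficients in the exponent, those of \<open>K\<close> sum to 2a -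
      2 - 2(a - 1) = 0.\<close>
    also have "\<dots> = exp ((a - 1) * X) * exp ((2 * b - 1) * Y) * exp ((2 * a - 1) * P) * exp ((b - 1) * Q)"
      unfolding exp_add[symmetric] by (rule arg_cong[of _ _ exp]) (simp add: algebra_simps)
    also have "\<dots> = f x"
      unfolding f_def X_Y_P_Q_K_def using x by (simp add: pw del: of_real_divide of_real_diff)
    finally show ?thesis by simp
  qed
  have "(\<lambda>x. C * (\<bar>g' x\<bar> *\<^sub>R ?B (g x))) absolutely_integrable_on {0<..<1}"
    using *(1) by (rule set_integrable_mult_right)
  thus "f absolutely_integrable_on {0<..<1}"
    using eq by (subst set_integrable_cong[OF refl refl]) auto
  have "integral {0<..<1} f = integral {0<..<1} (\<lambda>x. C * (\<bar>g' x\<bar> *\<^sub>R ?B (g x)))"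
    using eq by (intro integral_cong) auto
  also have "\<dots> = C * Beta a b" unfolding integral_mult_right *(2) ..
  finally show "integral {0<..<1} f = (2 / 3) powr (2 * a) * Beta a b" unfolding C_def by simp
qed

section \<open>The multiindex Bessel series\<close>

lemma growth_inverse_fact: "growth (- 1) (\<lambda>n. inverse (fact n))"
proof -
  have "rGamma (1 * of_nat n + 1) = inverse (fact n :: complex)" for n
    using Gamma_fact[of n, where 'a = complex] by (simp add: rGamma_inverse_Gamma add.commute)
  thus ?thesis using growth_rGamma[of 1 1] by simp
qed

text \<open>Exponents add up: \<kappa> from the Pochhammer quotient, -Re (\<alpha> j) from each
  reciprocal Gamma factor and -1 from the factorial; powers and constants contribute 0.\<close>

lemma growth_multiindex_bessel_term:
  assumes "\<kappa> > 0"
  shows "growth (\<kappa> - (\<Sum>j=1..m. Re (\<alpha> j)) - 1) (multiindex_bessel_term m \<alpha> \<beta> \<kappa> b \<gamma> c z)"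
proof -
  have "growth (0 + (\<kappa> + 0) + (\<Sum>j=1..m. - Re (\<alpha> j)) + (0 + - 1))
     (\<lambda>n. c ^ n * (Gamma (of_real \<kappa> * of_nat n + \<gamma>) * inverse (Gamma \<gamma>))
       * (\<Prod>j=1..m. rGamma (\<alpha> j * of_nat n + (\<beta> j + (b + 1) / 2))) * (z ^ n * inverse (fact n)))"
    by (intro growth_mult growth_power growth_Gamma growth_const growth_prod growth_rGamma growth_inverse_fact assms) auto
  also have "0 + (\<kappa> + 0) + (\<Sum>j=1..m. - Re (\<alpha> j)) + (0 + - 1) = \<kappa> - (\<Sum>j=1..m. Re (\<alpha> j)) - 1"
    by (simp add: sum_negf)
  also have "(\<lambda>n. c ^ n * (Gamma (of_real \<kappa> * of_nat n + \<gamma>) * inverse (Gamma \<gamma>))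
       * (\<Prod>j=1..m. rGamma (\<alpha> j * of_nat n + (\<beta> j + (b + 1) / 2))) * (z ^ n * inverse (fact n)))
     = multiindex_bessel_term m \<alpha> \<beta> \<kappa> b \<gamma> c z"
    unfolding multiindex_bessel_term_def[abs_def] gen_pochhammer_def
    by (simp only: divide_inverse add.assoc add.commute[of \<gamma>])
  finally show ?thesis .
qed

lemma multiindex_bessel_term_mult:
  "multiindex_bessel_term m \<alpha> \<beta> \<kappa> b \<gamma> c (z * s) n = multiindex_bessel_term m \<alpha> \<beta> \<kappa> b \<gamma> c z n * s ^ n"
  by (simp add: multiindex_bessel_term_def power_mult_distrib)

text \<open>The factor \<open>Gamma \<gamma>\<close> undoes the denominator of
  \<open>gen_pochhammer\<close>. What remains on the right is the quotient of Gamma functions that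
  the Beta integral will supply.\<close>

lemma fox_wright_term_eq:
  assumes "Gamma \<gamma> \<noteq> 0"
  shows "fox_wright_term [(\<gamma>, of_real \<kappa>), (\<xi>, 1)]
     (map (\<lambda>j. (\<beta> j + (b + 1) / 2, \<alpha> j)) [1..<Suc m] @ [(2 * \<xi> + \<sigma>, 1)]) (c * y) n
   = Gamma \<gamma> * multiindex_bessel_term m \<alpha> \<beta> \<kappa> b \<gamma> c y n * (Gamma (\<xi> + of_nat n) * rGamma (2 * \<xi> + \<sigma> + of_nat n))"
proof -
  have "(\<Prod>(b, B)\<leftarrow>map (\<lambda>j. (\<beta> j + (b + 1) / 2, \<alpha> j)) [1..<Suc m]. rGamma (b + B * of_nat n))
     = (\<Prod>j=1..m. rGamma (\<alpha> j * of_nat n + \<beta> j + (b + 1) / 2))"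
    by (simp add: o_def prod.distinct_set_conv_list[symmetric] atLeastLessThanSuc_atLeastAtMost add_ac del: upt_Suc)
  thus ?thesis using assms
    by (simp add: fox_wright_term_def multiindex_bessel_term_def gen_pochhammer_def power_mult_distrib del: upt_Suc)
qed

section \<open>Termwise integration of the Bessel series\<close>

theorem theorem7:
  fixes m :: nat and \<alpha> \<beta> :: "nat \<Rightarrow> complex" and \<gamma> b c \<xi> \<sigma> y :: complex and \<kappa> :: real
  assumes "\<kappa> > 0"
    and "(\<Sum>j=1..m. Re (\<alpha> j)) > max 0 (\<kappa> - 1)"
    and "\<And>j. j \<in> {1..m} \<Longrightarrow> Re (\<beta> j) > 0"
    and "Re \<gamma> > 0"
    and "Re (\<xi> + \<sigma>) > 0"
    and "Re \<xi> > 0"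
  shows "(\<forall>x\<in>{0..1::real}. summable (multiindex_bessel_term m \<alpha> \<beta> \<kappa> b \<gamma> c
             (y * (1 - of_real x / 4) * (1 - of_real x)\<^sup>2)))
    \<and> summable (fox_wright_term [(\<gamma>, of_real \<kappa>), (\<xi>, 1)]
             (map (\<lambda>j. (\<beta> j + (b + 1) / 2, \<alpha> j)) [1..<Suc m] @ [(2 * \<xi> + \<sigma>, 1)]) (c * y))
    \<and> ((\<lambda>x::real. of_real x powr (\<xi> + \<sigma> - 1)
             * of_real (1 - x) powr (2 * \<xi> - 1)
             * of_real (1 - x / 3) powr (2 * (\<xi> + \<sigma>) - 1)
             * of_real (1 - x / 4) powr (\<xi> - 1)
             * multiindex_bessel m \<alpha> \<beta> \<kappa> b \<gamma> c (y * (1 - of_real x / 4) * (1 - of_real x)\<^sup>2))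
         has_integral
           (Gamma (\<xi> + \<sigma>) / Gamma \<gamma> * (2 / 3) powr (2 * (\<xi> + \<sigma>))
             * fox_wright [(\<gamma>, of_real \<kappa>), (\<xi>, 1)]
                 (map (\<lambda>j. (\<beta> j + (b + 1) / 2, \<alpha> j)) [1..<Suc m] @ [(2 * \<xi> + \<sigma>, 1)]) (c * y)))
        {0..1}"
proof -
  define a where "a = \<xi> + \<sigma>"
  define T where "T = multiindex_bessel_term m \<alpha> \<beta> \<kappa> b \<gamma> c y"
  \<comment> \<open>This is 1 - g x for the substitution \<open>g\<close>, a real number between 0
    and 1; the argument of the Bessel function is \<open>y * s x\<close>.\<close>
  define s where "s = (\<lambda>x::real. (1 - complex_of_real x / 4) * (1 - of_real x)\<^sup>2)"
  define F where "F = fox_wright_term [(\<gamma>, of_real \<kappa>), (\<xi>, 1)]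
             (map (\<lambda>j. (\<beta> j + (b + 1) / 2, \<alpha> j)) [1..<Suc m] @ [(2 * \<xi> + \<sigma>, 1)]) (c * y)"
  define w where "w = (\<lambda>x::real. of_real x powr (a - 1) * of_real (1 - x) powr (2 * \<xi> - 1)
             * of_real (1 - x / 3) powr (2 * a - 1) * of_real (1 - x / 4) powr (\<xi> - 1))"
  define M where "M = (\<Sum>n. norm (T n))"
  have a: "Re a > 0" using assms by (simp add: a_def)
  have G: "Gamma \<gamma> \<noteq> 0" by (rule Gamma_complex_nonzero) fact
  \<comment> \<open>The sum of the real parts exceeds \<kappa> - 1, which says exactly that the
    growth exponent of the series is negative.\<close>
  have neg: "\<kappa> - (\<Sum>j=1..m. Re (\<alpha> j)) - 1 < 0" using assms(2) by linarith
  have growth_T: "growth (\<kappa> - (\<Sum>j=1..m. Re (\<alpha> j)) - 1) T"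
    unfolding T_def by (rule growth_multiindex_bessel_term) fact
  have T: "summable (\<lambda>n. norm (T n))"
    by (rule growth_summable[OF growth_T neg])
  have bessel_eq: "multiindex_bessel_term m \<alpha> \<beta> \<kappa> b \<gamma> c (y * (1 - of_real x / 4) * (1 - of_real x)\<^sup>2) = (\<lambda>n. T n * s x ^ n)" for x
    using multiindex_bessel_term_mult[of m \<alpha> \<beta> \<kappa> b \<gamma> c y "s x"] by (auto simp: T_def s_def mult_ac)
  have s_le: "norm (s x) \<le> 1" if "x \<in> {0..1}" for x
  proof -
    have "s x = of_real ((1 - x / 4) * (1 - x)\<^sup>2)" by (simp add: s_def)
    moreover have "(1 - x / 4) * (1 - x)\<^sup>2 \<le> 1"
      using that by (intro mult_le_one) (auto simp: power_le_one)
    moreover have "(1 - x / 4) * (1 - x)\<^sup>2 \<ge> 0" using that by auto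
    ultimately show ?thesis by (simp only: norm_of_real)
  qed
  have Ts_le: "norm (T n * s x ^ n) \<le> norm (T n)" if "x \<in> {0..1}" for n x
    using s_le[OF that] by (simp add: norm_mult norm_power mult_left_le power_le_one)
  have sum_Ts: "summable (\<lambda>n. T n * s x ^ n)" if "x \<in> {0..1}" for x
    using Ts_le[OF that] by (intro summable_comparison_test[OF _ T]) auto

  have F_eq: "F n = Gamma \<gamma> * T n * (Gamma (\<xi> + of_nat n) * rGamma (2 * \<xi> + \<sigma> + of_nat n))" for n
    unfolding F_def T_def by (rule fox_wright_term_eq[OF G])
  \<comment> \<open>The two additional Gamma factors have exponents 1 and -1, so the Fox-Wright
    series inherits the exponent of the Bessel series.\<close>
  have "growth (0 + (\<kappa> - (\<Sum>j=1..m. Re (\<alpha> j)) - 1) + (1 + - Re 1))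
     (\<lambda>n. Gamma \<gamma> * T n * (Gamma (of_real 1 * of_nat n + \<xi>) * rGamma (1 * of_nat n + (2 * \<xi> + \<sigma>))))"
    by (intro growth_mult growth_T growth_const growth_Gamma growth_rGamma) auto
  hence "growth (\<kappa> - (\<Sum>j=1..m. Re (\<alpha> j)) - 1) F"
    by (simp add: F_eq[abs_def] add_ac)
  hence sum_F: "summable F"
    using growth_summable[OF _ neg] summable_norm_cancel by blast

  define C where "C = Gamma a / Gamma \<gamma> * (2 / 3) powr (2 * a)"
  \<comment> \<open>The power \<open>s x ^ n\<close> is absorbed into the weight by replacing \<xi>
    with \<xi> + n, and the Lavoie-Trottier integral applies with these parameters.\<close>
  have int_n: "((\<lambda>x. w x * (T n * s x ^ n)) has_integral C * F n) {0<..<1}" for n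
  proof -
    let ?f = "\<lambda>x::real. of_real x powr (a - 1) * of_real (1 - x) powr (2 * (\<xi> + of_nat n) - 1)
      * of_real (1 - x / 3) powr (2 * a - 1) * of_real (1 - x / 4) powr (\<xi> + of_nat n - 1)"
    have "Re (\<xi> + of_nat n) > 0" using assms by simp
    from integral_Lavoie_Trottier[OF a this] have "(?f has_integral (2 / 3) powr (2 * a) * Beta a (\<xi> + of_nat n)) {0<..<1}"
      by (auto simp: has_integral_iff dest: set_lebesgue_integral_eq_integral(1))
    hence "((\<lambda>x. T n * ?f x) has_integral T n * ((2 / 3) powr (2 * a) * Beta a (\<xi> + of_nat n))) {0<..<1}"
      by (rule has_integral_mult_right)
    \<comment> \<open>Here a + \<xi> + n = 2\<xi> + \<sigma> + n, so the Beta value gives the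
      quotient of Gamma functions in \<open>F n\<close>, with \<Gamma>(a) moved into
      \<open>C\<close>.\<close>
    also have "T n * ((2 / 3) powr (2 * a) * Beta a (\<xi> + of_nat n)) = C * F n"
      using G by (simp add: C_def F_eq Beta_altdef a_def add_ac mult_ac)
    finally show ?thesis
    proof (rule has_integral_eq[rotated])
      fix x :: real assume x: "x \<in> {0<..<1}"
      have p: "complex_of_real r powr (z + of_nat k) = of_real r powr z * of_real r ^ k" if "r > 0" for r z k
        using that by (simp add: powr_add powr_nat')
      have "complex_of_real (1 - x) powr (2 * (\<xi> + of_nat n) - 1) = complex_of_real (1 - x) powr ((2 * \<xi> - 1) + of_nat (2 * n))"
        by (simp add: algebra_simps)
      also have "\<dots> = complex_of_real (1 - x) powr (2 * \<xi> - 1) * (of_real (1 - x) ^ 2) ^ n"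
        using x by (subst p) (auto simp: power_mult)
      finally have 1: "complex_of_real (1 - x) powr (2 * (\<xi> + of_nat n) - 1) = \<dots>" .
      have "complex_of_real (1 - x / 4) powr (\<xi> + of_nat n - 1) = complex_of_real (1 - x / 4) powr ((\<xi> - 1) + of_nat n)"
        by (simp add: algebra_simps)
      also have "\<dots> = complex_of_real (1 - x / 4) powr (\<xi> - 1) * of_real (1 - x / 4) ^ n"
        using x by (subst p) auto
      finally have 2: "complex_of_real (1 - x / 4) powr (\<xi> + of_nat n - 1) = \<dots>" .
      have "s x ^ n = of_real (1 - x / 4) ^ n * (of_real (1 - x) ^ 2) ^ n"
        by (simp add: s_def power_mult_distrib)
      thus "T n * ?f x = w x * (T n * s x ^ n)"
        unfolding 1 2 w_def by (simp only: mult_ac)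
    qed
  qed

  have "w absolutely_integrable_on {0<..<1}"
    unfolding w_def by (rule integral_Lavoie_Trottier) fact+
  hence w: "(\<lambda>x. norm (w x)) integrable_on {0<..<1}"
    by (rule absolutely_integrable_on_def[THEN iffD1, THEN conjunct2])
  \<comment> \<open>All partial sums are dominated by \<open>norm (w x) * M\<close>, which is
    integrable because the weight is absolutely integrable and \<open>M\<close> does not depend on
    \<open>x\<close>.\<close>
  have "((\<lambda>x. w x * (\<Sum>n. T n * s x ^ n)) has_integral C * (\<Sum>n. F n)) {0<..<1}"
  proof (rule has_integral_dominated_convergence)
    show "((\<lambda>x. \<Sum>n<k. w x * (T n * s x ^ n)) has_integral (\<Sum>n<k. C * F n)) {0<..<1}" for k
      by (intro has_integral_sum int_n) auto
    show "(\<lambda>x. norm (w x) * M) integrable_on {0<..<1}"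
      using w by (rule integrable_on_mult_left)
    show "\<forall>x\<in>{0<..<1}. norm (\<Sum>n<k. w x * (T n * s x ^ n)) \<le> norm (w x) * M" for k
    proof
      fix x :: real assume x: "x \<in> {0<..<1}"
      have "norm (\<Sum>n<k. T n * s x ^ n) \<le> (\<Sum>n<k. norm (T n))"
        using x by (intro sum_norm_le Ts_le) auto
      also have "\<dots> \<le> M" unfolding M_def by (rule sum_le_suminf[OF T]) auto
      finally show "norm (\<Sum>n<k. w x * (T n * s x ^ n)) \<le> norm (w x) * M"
        unfolding sum_distrib_left[symmetric] norm_mult by (rule mult_left_mono) auto
    qed
    show "\<forall>x\<in>{0<..<1}. (\<lambda>k. \<Sum>n<k. w x * (T n * s x ^ n)) \<longlonglongrightarrow> w x * (\<Sum>n. T n * s x ^ n)"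
      unfolding sum_distrib_left[symmetric]
      by (intro ballI tendsto_mult tendsto_const summable_LIMSEQ sum_Ts) auto
    show "(\<lambda>k. \<Sum>n<k. C * F n) \<longlonglongrightarrow> C * (\<Sum>n. F n)"
      unfolding sum_distrib_left[symmetric]
      by (intro tendsto_mult tendsto_const summable_LIMSEQ sum_F)
  qed
  hence "((\<lambda>x. w x * (\<Sum>n. T n * s x ^ n)) has_integral C * (\<Sum>n. F n)) {0..1}"
    by (simp add: has_integral_Icc_iff_Ioo)
  thus ?thesis
    using sum_Ts sum_F
    unfolding multiindex_bessel_def fox_wright_def bessel_eq F_def[symmetric] w_def C_def a_def by blast
qed

end
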